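(* Let $D(x)\in\mathbb{Q}[x]$ be monic, squarefree, and of degree $2g+2$, and set $y^2=D(x)$. Suppose the domain $\mathbb{Q}[x,y]$ contains a unit of degree $m>g$ and norm $k$. Then: (a) If $m$ and $g$ have the same parity, then $k=c^2$ is a square in $\mathbb{Q}$. (b) If $k=c^2$ is a square in $\mathbb{Q}$, there is a positive integer $s$ so that $D$ is a product of polynomials over $\mathbb{Q}$ of degrees $m-2s$ and $2g+2+2s-m$. Thus $D$ is reducible over $\mathbb{Q}$ if $m$ is odd. (c) If $k=c^2$ is not a square in $\mathbb{Q}$, then $D$ factorises over $\mathbb{Q}(c)$ as a product of two polynomials conjugate over $\mathbb{Q}(c)$, so each of degree $g+1$.
   Context: Elements of $\mathbb{Q}[x,y]$, where $y^2=D(x)$, are uniquely of the form $a+by$ with $a,b\in\mathbb{Q}[x]$. The norm of $a+by$ is $a^2-Db^2$, and $a+by$ is a unit exactly when its norm is a nonzero constant $k\in\mathbb{Q}$. The degree of a unit $a+by$ is $m=\deg a$. The symbol $c$ denotes a square root of $k$, so $c$ is quadratic irrational over $\mathbb{Q}$ when $k$ is not a square in $\mathbb{Q}$; "conjugate" in (c) refers to conjugation in the quadratic extension $\mathbb{Q}(c)$ of $\mathbb{Q}$.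
   Formalization: In (b), s is required to be positive except when m = g+1 is odd, where s may be 0: there the claim fails as stated, e.g. D = x^2-1, g = 0, unit x+y of degree 1 and norm 1, where s ≥ 1 would give a negative degree m-2s. *)

theory Defs
  imports Complex_Main "HOL-Computational_Algebra.Computational_Algebra" "HOL-Algebra.Ring"
begin

text \<open>
  The ring \<open>\<rat>[x,y]\<close> with \<open>y\<^sup>2 = D(x)\<close>.
  The pair \<open>(a, b)\<close> stands for \<open>a + b y\<close>.
\<close>

definition coord_ring :: "rat poly \<Rightarrow> (rat poly \<times> rat poly) ring" where
  "coord_ring D =
     \<lparr>carrier = UNIV,
      mult = (\<lambda>(a, b) (a', b'). (a * a' + D * b * b', a * b' + a' * b)),
      one = (1, 0),
      zero = (0, 0),
      add = (\<lambda>(a, b) (a', b'). (a + a', b + b'))\<rparr>"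

definition coord_norm :: "rat poly \<Rightarrow> rat poly \<times> rat poly \<Rightarrow> rat poly" where
  "coord_norm D = (\<lambda>(a, b). a ^ 2 - D * b ^ 2)"

definition coord_degree :: "rat poly \<times> rat poly \<Rightarrow> nat" where
  "coord_degree = (\<lambda>(a, b). degree a)"

lemma cring_coord_ring: "cring (coord_ring D)"
proof -
  have "\<exists>y. add (coord_ring D) y x = zero (coord_ring D)" for x
    by (rule exI[of _ "(- fst x, - snd x)"]) (simp add: coord_ring_def split_beta)
  then have inv: "\<exists>y\<in>carrier (coord_ring D). add (coord_ring D) y x = zero (coord_ring D)" for x
    by (simp add: coord_ring_def)
  show ?thesis
    by (intro cringI abelian_groupI comm_monoidI inv)
       (simp_all add: coord_ring_def split_beta algebra_simps)
qed

lemma coord_norm_mult: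
  "coord_norm D (mult (coord_ring D) u v) = coord_norm D u * coord_norm D v"
  by (cases u; cases v)
     (simp add: coord_ring_def coord_norm_def power2_eq_square algebra_simps)

lemma Units_coord_ring_iff:
  "u \<in> Units (coord_ring D) \<longleftrightarrow> (\<exists>k. k \<noteq> 0 \<and> coord_norm D u = [:k:])"
proof
  assume "u \<in> Units (coord_ring D)"
  then obtain v where "mult (coord_ring D) v u = one (coord_ring D)"
    by (auto simp: Units_def)
  then have "coord_norm D v * coord_norm D u = coord_norm D (one (coord_ring D))"
    by (simp flip: coord_norm_mult)
  also have "\<dots> = 1"
    by (simp add: coord_ring_def coord_norm_def)
  finally have "coord_norm D v * coord_norm D u = 1" .
  then have "coord_norm D u dvd 1"
    by (metis dvd_triv_right)
  then show "\<exists>k. k \<noteq> 0 \<and> coord_norm D u = [:k:]"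
    by (auto simp: is_unit_poly_iff)
next
  assume "\<exists>k. k \<noteq> 0 \<and> coord_norm D u = [:k:]"
  then obtain k where k: "k \<noteq> 0" "coord_norm D u = [:k:]" by blast
  obtain a b where u: "u = (a, b)" by (cases u)
  define i where "i = [:inverse k:]"
  have i: "i * (a ^ 2 - D * b ^ 2) = 1"
    using k by (simp add: i_def u coord_norm_def one_pCons)
  define v where "v = (i * a, - (i * b))"
  have "a * (i * a) + D * b * - (i * b) = 1" "a * - (i * b) + i * a * b = 0"
    using i by (simp_all add: power2_eq_square algebra_simps)
  then have "mult (coord_ring D) u v = one (coord_ring D)"
    by (simp add: coord_ring_def u v_def)
  moreover have "mult (coord_ring D) v u = mult (coord_ring D) u v"
    by (simp add: coord_ring_def split_beta algebra_simps)
  moreover have "carrier (coord_ring D) = UNIV"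
    by (simp add: coord_ring_def)
  ultimately show "u \<in> Units (coord_ring D)"
    unfolding Units_def by (metis (mono_tags, lifting) UNIV_I mem_Collect_eq)
qed

definition quad_field :: "complex \<Rightarrow> complex set" where
  "quad_field c = {of_rat r + of_rat t * c | r t. True}"

text \<open>
  Conjugation of \<open>\<rat>(c)\<close> over \<open>\<rat>\<close>. It is meaningful for
  irrational \<open>c\<close>, where \<open>1, c\<close> are linearly independent over \<open>\<rat>\<close>,
  and on elements of \<open>quad_field c\<close>.
\<close>

definition quad_conj :: "complex \<Rightarrow> complex \<Rightarrow> complex" where
  "quad_conj c z = (THE w. \<exists>r t. z = of_rat r + of_rat t * c \<and> w = of_rat r - of_rat t * c)"

lemma quad_conj_eq:
  assumes "c \<notin> \<rat>"
  shows "quad_conj c (of_rat r + of_rat t * c) = of_rat r - of_rat t * c"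
proof -
  have "r = r' \<and> t = t'"
    if eq: "of_rat r + of_rat t * c = of_rat r' + of_rat t' * c" for r' t'
  proof -
    have *: "of_rat (t - t') * c = of_rat (r' - r)"
      using eq by (simp add: of_rat_diff algebra_simps)
    have "t = t'"
    proof (rule ccontr)
      assume "t \<noteq> t'"
      with * have "c = of_rat ((r' - r) / (t - t'))"
        by (simp add: of_rat_divide field_simps)
      with assms show False by simp
    qed
    with eq show ?thesis by simp
  qed
  then show ?thesis
    unfolding quad_conj_def by (intro the_equality) blast+
qed

end

theory Submission
  imports Defs "HOL-Computational_Algebra.Field_as_Ring"
begin

text \<open>
  Write the unit as \<open>a + b y\<close>, so that \<open>a\<^sup>2 - k = D b\<^sup>2\<close>. Since \<open>m > 0\<close>, comparing degrees gives
  \<open>deg b = m - g - 1\<close>.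

  If \<open>k = c\<^sup>2\<close> with \<open>c\<close> rational, the factors \<open>a - c\<close> and \<open>a + c\<close> of \<open>D b\<^sup>2\<close> are coprime of
  degree \<open>m\<close>, so \<open>D\<close> and \<open>b\<close> split
  as \<open>D = p q\<close> and \<open>b = r s\<close> with \<open>p r\<^sup>2\<close> associated to one factor and \<open>q s\<^sup>2\<close> to the other
  (lemma \<open>coprime_factors_split\<close>). Hence \<open>deg p = m - 2 deg r\<close> and \<open>deg q = m - 2 deg s\<close>, which
  is (b) with the positive integer \<open>deg r\<close> or \<open>deg s\<close>, whichever is available; if both
  are zero then \<open>b\<close> is constant and \<open>m = g + 1\<close>. When \<open>m\<close> is odd so are both degrees, so neither
  factor is constant.

  If \<open>k\<close> is not a square, the key fact is that every divisor of \<open>a\<^sup>2 - k\<close> is, up to a constant, a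
  norm \<open>A\<^sup>2 - k B\<^sup>2\<close> with \<open>deg B < deg A\<close>, and in particular has even degree (lemma
  \<open>divisor_is_norm\<close>). For the divisor \<open>b\<close> this says that \<open>m - g - 1\<close> is even, which is (a). For the
  divisor \<open>D\<close> it says that \<open>D = (A + c B) (A - c B)\<close> over \<open>\<rat>(c)\<close>, which is (c) (lemma
  \<open>conjugate_factorisation\<close>). Working with pairs \<open>(A, B)\<close> of rational polynomials avoids any
  arithmetic in the ring \<open>\<rat>(c)[x]\<close>.

  The key fact is proved as one proves by Thue's lemma that a divisor of \<open>a\<^sup>2 + 1\<close> is a sum of two
  squares: for \<open>f\<close> dividing \<open>a\<^sup>2 - k\<close> there are \<open>P\<close> and \<open>Q \<noteq> 0\<close>, both of degree at most
  \<open>deg f / 2\<close>, with \<open>P \<equiv> a Q\<close> modulo \<open>f\<close> (lemma \<open>poly_thue\<close>). Then \<open>f\<close> divides \<open>P\<^sup>2 - k Q\<^sup>2\<close>, whose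
  degree does not exceed that of \<open>f\<close>. For polynomials the degree bound is sharp enough to leave only
  a constant cofactor, so no further descent is needed.
\<close>

section \<open>Small multiples modulo a polynomial\<close>

text \<open>
  The polynomial form of Thue's lemma, in the shape of a rational approximation of \<open>a / f\<close>. By
  dimension count: the \<open>d + 1\<close> coefficients of \<open>Q\<close> must kill \<open>d\<close> coefficients of \<open>a Q\<close> modulo \<open>f\<close>.
  The proof instead follows the Euclidean algorithm: with \<open>r\<close> the remainder of \<open>a\<close>, an identity
  \<open>f S - P = r Q\<close> solves the problem for \<open>f\<close> modulo \<open>r\<close> through \<open>S\<close> and, read the other way, for \<open>r\<close>
  modulo \<open>f\<close> through \<open>Q\<close>.
\<close>

lemma poly_thue:
  fixes f a :: "'a::field poly"
  assumes "f \<noteq> 0"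
  shows "\<exists>P Q. Q \<noteq> 0 \<and> degree Q \<le> d \<and> (P = 0 \<or> degree P + d < degree f) \<and> f dvd a * Q - P"
  using assms
proof (induction "degree f" arbitrary: f a d rule: less_induct)
  case less
  define r where "r = a mod f"
  have f_dvd: "f dvd a - r"
    unfolding r_def by (metis dvd_minus_mod)
  have deg_r: "r = 0 \<or> degree r < degree f"
    using degree_mod_less[OF less.prems, of a] by (simp add: r_def)
  show ?case
  proof (cases "r = 0 \<or> degree r + d < degree f")
    case True
    then show ?thesis
      using f_dvd by (intro exI[of _ r] exI[of _ 1]) auto
  next
    case False
    then have r: "r \<noteq> 0" "degree r < degree f" "degree f \<le> degree r + d"
      using deg_r by auto
    \<comment> \<open>\<open>Q\<close> will exceed \<open>S\<close> in degree by \<open>degree f - degree r\<close>, so \<open>S\<close> gets that much less room.\<close>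
    define e where "e = d - (degree f - degree r)"
    from less.hyps[OF r(2) r(1), of e f] obtain P S where
      S: "S \<noteq> 0" "degree S \<le> e" and P: "P = 0 \<or> degree P + e < degree r" and "r dvd f * S - P"
      by blast
    then obtain Q where Q: "f * S - P = r * Q"
      by blast
    have deg_fS: "degree (f * S) = degree f + degree S"
      using less.prems S(1) by (simp add: degree_mult_eq)
    have deg_P: "P = 0 \<or> degree P < degree (f * S)"
      using P r(2) deg_fS by auto
    have deg_fSP: "degree (f * S - P) = degree f + degree S"
    proof (cases "P = 0")
      case False
      then have "degree (- P) < degree (f * S)"
        using deg_P by simp
      then show ?thesis
        using degree_add_eq_left[of "- P" "f * S"] deg_fS by simp
    qed (simp add: deg_fS)
    have "f * S \<noteq> P"
      using deg_P less.prems S(1) by auto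
    then have "Q \<noteq> 0"
      using Q by auto
    have "degree r + degree Q = degree f + degree S"
      using deg_fSP Q r(1) \<open>Q \<noteq> 0\<close> by (simp add: degree_mult_eq)
    then have "degree Q \<le> d"
      using S(2) r by (simp add: e_def)
    moreover have "- P = 0 \<or> degree (- P) + d < degree f"
      using P r by (auto simp: e_def)
    moreover have "f dvd a * Q - (- P)"
    proof -
      have "a * Q - (- P) = (a - r) * Q + f * S"
        using Q by (simp add: algebra_simps)
      then show ?thesis
        using f_dvd by simp
    qed
    ultimately show ?thesis
      using \<open>Q \<noteq> 0\<close> by blast
  qed
qed

section \<open>Divisors of \<open>a\<^sup>2 - k\<close> as norms\<close>

lemma norm_form_eq_0_imp_square:
  fixes P Q :: "'a::field poly"
  assumes "P ^ 2 - smult k (Q ^ 2) = 0" and "Q \<noteq> 0"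
  shows "\<exists>r. k = r ^ 2"
proof -
  have "lead_coeff (P ^ 2) = lead_coeff (smult k (Q ^ 2))"
    using assms(1) by simp
  then have "lead_coeff P ^ 2 = k * lead_coeff Q ^ 2"
    by (simp only: lead_coeff_power lead_coeff_smult)
  then have "k = (lead_coeff P / lead_coeff Q) ^ 2"
    using assms(2) by (simp add: power_divide)
  then show ?thesis ..
qed

text \<open>
  Squaring the congruence \<open>P \<equiv> a Q\<close> of \<open>poly_thue\<close> shows that \<open>f\<close> divides \<open>N = P\<^sup>2 - k Q\<^sup>2\<close>, which
  is nonzero because \<open>k\<close> is not a square. Balancing the two degree bounds gives \<open>deg N \<le> 2 \<lfloor>deg f / 2\<rfloor>\<close>,
  so \<open>deg f\<close> is even and \<open>N\<close> is a constant multiple of \<open>f\<close>, with leading term coming from \<open>- k Q\<^sup>2\<close>. As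
  \<open>- k (P\<^sup>2 - k Q\<^sup>2) = (k Q)\<^sup>2 - k P\<^sup>2\<close> is again a norm (\<open>- k\<close> being the norm of \<open>c\<close>), exchanging the two
  components turns \<open>N\<close> into a form with monic \<open>A\<close>.
\<close>

lemma divisor_is_norm:
  fixes f a :: "'a::field poly"
  assumes nonsquare: "\<nexists>r. k = r ^ 2" and "f \<noteq> 0" and "f dvd a ^ 2 - [:k:]"
  shows "\<exists>A B. f = smult (lead_coeff f) (A ^ 2 - smult k (B ^ 2)) \<and>
           degree f = 2 * degree A \<and> (B = 0 \<or> degree B < degree A)"
proof -
  have "k \<noteq> 0"
    using nonsquare by (metis zero_power2)
  define d where "d = degree f div 2"
  obtain P Q where Q: "Q \<noteq> 0" "degree Q \<le> d" and P: "P = 0 \<or> degree P + d < degree f"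
    and dvd: "f dvd a * Q - P"
    using poly_thue[OF assms(2), of d a] by blast
  define N where "N = P ^ 2 - smult k (Q ^ 2)"
  have "N \<noteq> 0"
    using norm_form_eq_0_imp_square[of P k Q] Q(1) nonsquare by (auto simp: N_def)
  have "N = (a ^ 2 - [:k:]) * Q ^ 2 - (a * Q - P) * (a * Q + P)"
    by (simp add: N_def power2_eq_square algebra_simps)
  then have "f dvd N"
    using dvd assms(3) by simp
  then obtain h where h: "N = f * h" ..
  then have "h \<noteq> 0"
    using \<open>N \<noteq> 0\<close> by auto
  have deg_N: "degree N = degree f + degree h"
    using h \<open>h \<noteq> 0\<close> assms(2) by (simp add: degree_mult_eq)
  have deg_Q2: "degree (smult k (Q ^ 2)) = 2 * degree Q"
    using \<open>k \<noteq> 0\<close> by (simp add: degree_power_eq Q(1))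
  have "degree (P ^ 2) \<le> 2 * d"
    using P by (cases "P = 0") (auto simp: degree_power_eq d_def)
  then have "degree N \<le> 2 * d"
    unfolding N_def using deg_Q2 Q(2) by (intro degree_diff_le) auto
  with deg_N have deg_f: "degree f = 2 * d" and "degree h = 0" and "degree N = 2 * d"
    unfolding d_def by linarith+
  have P_small: "P = 0 \<or> degree P < d"
    using P deg_f by auto
  have coeff_P2: "coeff (P ^ 2) (2 * d) = 0"
    using P_small by (cases "P = 0") (auto simp: degree_power_eq intro!: coeff_eq_0)
  \<comment> \<open>Otherwise neither square reaches the degree \<open>2 d\<close> of \<open>N\<close>.\<close>
  have "degree Q = d"
  proof (rule ccontr)
    assume "degree Q \<noteq> d"
    then have "coeff N (2 * d) = 0"
      using Q(2) deg_Q2 coeff_P2 by (simp add: N_def coeff_eq_0 degree_power_eq Q(1))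
    then show False
      using \<open>degree N = 2 * d\<close> \<open>N \<noteq> 0\<close> by (metis leading_coeff_0_iff)
  qed
  define q where "q = lead_coeff Q"
  have "q \<noteq> 0"
    using Q(1) by (simp add: q_def)
  have "coeff (Q ^ 2) (2 * d) = q ^ 2"
    using lead_coeff_power[of Q 2] \<open>degree Q = d\<close> by (simp add: q_def degree_power_eq Q(1))
  then have "lead_coeff N = - (k * q ^ 2)"
    using coeff_P2 \<open>degree N = 2 * d\<close> by (simp add: N_def)
  moreover obtain e where e: "h = [:e:]"
    using \<open>degree h = 0\<close> degree_eq_zeroE by blast
  moreover have "e \<noteq> 0"
    using e \<open>h \<noteq> 0\<close> by auto
  ultimately have lead: "e * lead_coeff f = - (k * q ^ 2)"
    using h by simp
  \<comment> \<open>This is \<open>P + c Q\<close> divided by \<open>c q\<close>, where \<open>c\<^sup>2 = k\<close>: the rational part is \<open>Q / q\<close>.\<close>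
  define A where "A = smult (1 / q) Q"
  define B where "B = smult (1 / (k * q)) P"
  have "smult e f = N"
    using h e by simp
  also have "N = smult (- (k * q ^ 2)) (A ^ 2 - smult k (B ^ 2))"
  proof -
    have "Q = smult q A" "P = smult (k * q) B"
      using \<open>k \<noteq> 0\<close> \<open>q \<noteq> 0\<close> by (simp_all add: A_def B_def)
    then have "N = smult ((k * q) ^ 2) (B ^ 2) - smult (k * q ^ 2) (A ^ 2)"
      by (simp only: N_def smult_power smult_smult)
    also have "(k * q) ^ 2 = k * q ^ 2 * k"
      by (simp add: power2_eq_square)
    finally show ?thesis
      by (simp add: smult_diff_right)
  qed
  also have "\<dots> = smult e (smult (lead_coeff f) (A ^ 2 - smult k (B ^ 2)))"
    by (simp only: lead smult_smult)
  finally have "smult e (f - smult (lead_coeff f) (A ^ 2 - smult k (B ^ 2))) = 0"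
    by (simp only: smult_diff_right[of e f] diff_self)
  then have "f = smult (lead_coeff f) (A ^ 2 - smult k (B ^ 2))"
    using \<open>e \<noteq> 0\<close> by (simp only: smult_eq_0_iff) simp
  moreover have "degree f = 2 * degree A" "B = 0 \<or> degree B < degree A"
    using \<open>q \<noteq> 0\<close> \<open>degree Q = d\<close> deg_f P_small by (auto simp: A_def B_def)
  ultimately show ?thesis
    by (intro exI[of _ A] exI[of _ B] conjI)
qed

section \<open>Coprime factors of \<open>D b\<^sup>2\<close>\<close>

text \<open>
  A divisor of a product splits into divisors of the factors; this is applied to \<open>D\<close> and to \<open>b\<close>.
  Coprimality of \<open>u\<close> and \<open>v\<close> puts \<open>p r\<^sup>2\<close> entirely into \<open>u\<close> and \<open>q s\<^sup>2\<close> entirely into \<open>v\<close>, and as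
  \<open>u v = (p r\<^sup>2) (q s\<^sup>2)\<close> there is no loss of degree on either side.
\<close>

lemma coprime_factors_split:
  fixes u v D b :: "'a::field_gcd poly"
  assumes "coprime u v" and "u * v = D * b ^ 2" and "u * v \<noteq> 0"
  shows "\<exists>p q r s. D = p * q \<and> b = r * s \<and>
           degree u = degree p + 2 * degree r \<and> degree v = degree q + 2 * degree s"
proof -
  have "D dvd u * v" "b dvd u * v"
    using assms(2) by (simp_all add: power2_eq_square)
  then obtain p q r s where D: "D = p * q" "p dvd u" "q dvd v" and b: "b = r * s" "r dvd u" "s dvd v"
    using division_decomp by metis
  have nz: "p \<noteq> 0" "q \<noteq> 0" "r \<noteq> 0" "s \<noteq> 0" "u \<noteq> 0" "v \<noteq> 0"
    using assms(2,3) D(1) b(1) by auto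
  have prod: "u * v = (p * r ^ 2) * (q * s ^ 2)"
    using assms(2) D(1) b(1) by (simp add: power2_eq_square algebra_simps)
  have "coprime (p * r ^ 2) v" "coprime (q * s ^ 2) u"
    using assms(1) D b by (auto simp: ac_simps intro: coprime_imp_coprime dvd_trans coprime_divisors)
  then have dvd: "p * r ^ 2 dvd u" "q * s ^ 2 dvd v"
    using prod by (metis coprime_dvd_mult_left_iff dvd_triv_left,
                   metis coprime_dvd_mult_right_iff dvd_triv_right)
  have deg: "degree (p * r ^ 2) = degree p + 2 * degree r" "degree (q * s ^ 2) = degree q + 2 * degree s"
    using nz by (simp_all add: degree_mult_eq degree_power_eq)
  have "degree (p * r ^ 2) \<le> degree u" "degree (q * s ^ 2) \<le> degree v"
    using dvd nz by (auto intro: dvd_imp_degree_le)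
  moreover have "degree u + degree v = degree (p * r ^ 2) + degree (q * s ^ 2)"
    using arg_cong[OF prod, of degree] nz by (simp add: degree_mult_eq)
  ultimately show ?thesis
    using D(1) b(1) deg by (intro exI[of _ p] exI[of _ q] exI[of _ r] exI[of _ s]) auto
qed

lemma degree_diff_const [simp]:
  fixes a :: "'a::ab_group_add poly"
  shows "degree (a - [:c:]) = degree a"
proof (cases "degree a = 0")
  case True
  then obtain e where "a = [:e:]"
    by (rule degree_eq_zeroE)
  then show ?thesis
    by simp
next
  case False
  then show ?thesis
    unfolding diff_conv_add_uminus by (intro degree_add_eq_left) simp
qed

lemma coprime_diff_add_const:
  fixes a :: "'a::field_char_0 poly"
  assumes "c \<noteq> 0"
  shows "coprime (a - [:c:]) (a + [:c:])"
proof (rule coprimeI)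
  fix d assume "d dvd a - [:c:]" "d dvd a + [:c:]"
  then have "d dvd (a + [:c:]) - (a - [:c:])"
    by (rule dvd_diff[rotated])
  then have "d dvd [:2 * c:]"
    by simp
  moreover have "is_unit [:2 * c:]"
    using assms by (simp add: is_unit_triv)
  ultimately show "is_unit d"
    by (rule dvd_trans)
qed

section \<open>Norm forms as conjugate factorisations\<close>

lemma conjugate_factorisation:
  fixes A B :: "rat poly" and c :: complex
  assumes "c \<notin> \<rat>" and "c ^ 2 = of_rat k" and "B = 0 \<or> degree B < degree A"
  defines "p \<equiv> map_poly of_rat A + smult c (map_poly of_rat B)"
  defines "q \<equiv> map_poly (quad_conj c) p"
  shows "set (coeffs p) \<subseteq> quad_field c" "set (coeffs q) \<subseteq> quad_field c"
    "map_poly of_rat (A ^ 2 - smult k (B ^ 2)) = p * q"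
    "degree p = degree A" "degree q = degree A"
proof -
  have coeff_p: "coeff p i = of_rat (coeff A i) + of_rat (coeff B i) * c" for i
    by (simp add: p_def coeff_map_poly)
  have "quad_conj c 0 = 0"
    using quad_conj_eq[OF assms(1), of 0 0] by simp
  then have coeff_q: "coeff q i = of_rat (coeff A i) + of_rat (- coeff B i) * c" for i
    by (simp add: q_def coeff_map_poly coeff_p quad_conj_eq[OF assms(1)] of_rat_minus)
  show "set (coeffs p) \<subseteq> quad_field c" "set (coeffs q) \<subseteq> quad_field c"
    by (auto simp: coeffs_def quad_field_def coeff_p coeff_q simp del: of_rat_minus)
  define A' B' :: "complex poly" where "A' = map_poly of_rat A" and "B' = map_poly of_rat B"
  have p: "p = A' + smult c B'"
    by (simp add: p_def A'_def B'_def)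
  have q: "q = A' - smult c B'"
    by (rule poly_eqI) (simp add: coeff_q A'_def B'_def coeff_map_poly of_rat_minus)
  have square: "map_poly of_rat (F ^ 2) = (map_poly of_rat F :: complex poly) ^ 2" for F
    by (rule poly_eqI)
      (simp add: coeff_map_poly power2_eq_square coeff_mult of_rat_mult of_rat_sum)
  have "map_poly of_rat (A ^ 2 - smult k (B ^ 2)) =
      map_poly of_rat (A ^ 2) - smult (c ^ 2) (map_poly of_rat (B ^ 2))"
    unfolding assms(2) by (rule poly_eqI) (simp add: coeff_map_poly of_rat_diff of_rat_mult)
  also have "\<dots> = A' ^ 2 - smult (c ^ 2) (B' ^ 2)"
    by (simp only: square A'_def B'_def)
  also have "\<dots> = p * q"
    by (simp add: p q power2_eq_square algebra_simps)
  finally show "map_poly of_rat (A ^ 2 - smult k (B ^ 2)) = p * q" .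
  have deg: "degree A' = degree A" "B = 0 \<longrightarrow> B' = 0" "degree B' = degree B"
    by (simp_all add: A'_def B'_def degree_map_poly)
  then have B': "smult c B' = 0 \<or> degree (smult c B') < degree A'"
    using assms(3) degree_smult_le[of c B'] by (auto intro: le_less_trans)
  then show "degree p = degree A"
    using deg(1) degree_add_eq_left[of "smult c B'" A'] by (auto simp: p)
  show "degree q = degree A"
    using B' deg(1) degree_add_eq_left[of "- smult c B'" A'] by (auto simp: q)
qed

section \<open>Units and factorisations of \<open>D\<close>\<close>

theorem theorem1:
  fixes D :: "rat poly" and u :: "rat poly \<times> rat poly"
    and k :: rat and g m :: nat
  assumes "lead_coeff D = 1" and "squarefree D" and "degree D = 2 * g + 2"
    and "u \<in> Units (coord_ring D)"
    and "coord_degree u = m" and "m > g"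
    and "coord_norm D u = [:k:]"
  shows "((even m \<longleftrightarrow> even g) \<longrightarrow> (\<exists>c::rat. k = c ^ 2)) \<and>
         ((\<exists>c::rat. k = c ^ 2) \<longrightarrow>
           (\<exists>(s::nat) p q.
              (s > 0 \<or> (m = g + 1 \<and> odd m)) \<and> D = p * q \<and>
              int (degree p) = int m - 2 * int s \<and>
              int (degree q) = 2 * int g + 2 + 2 * int s - int m) \<and>
           (odd m \<longrightarrow> \<not> irreducible D)) \<and>
         ((\<nexists>r::rat. k = r ^ 2) \<longrightarrow>
           (\<forall>c::complex. c ^ 2 = of_rat k \<longrightarrow>
              (\<exists>p q. set (coeffs p) \<subseteq> quad_field c \<and> set (coeffs q) \<subseteq> quad_field c \<and>
                 q = map_poly (quad_conj c) p \<and>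
                 map_poly of_rat D = p * q \<and>
                 degree p = g + 1 \<and> degree q = g + 1)))"
proof -
  obtain a b where u: "u = (a, b)"
    by (cases u)
  have eq: "a ^ 2 - [:k:] = D * b ^ 2"
    using assms(7) by (simp add: u coord_norm_def algebra_simps)
  have "degree a = m"
    using assms(5) by (simp add: u coord_degree_def)
  have "k \<noteq> 0"
    using assms(4,7) by (auto simp: Units_coord_ring_iff)
  have "D \<noteq> 0" "m > 0" "a \<noteq> 0"
    using assms(1,6) \<open>degree a = m\<close> by auto
  have "degree (a ^ 2) = 2 * m"
    using \<open>degree a = m\<close> \<open>a \<noteq> 0\<close> by (simp add: degree_power_eq)
  then have deg_lhs: "degree (a ^ 2 - [:k:]) = 2 * m"
    by simp
  then have "b \<noteq> 0"
    using eq \<open>m > 0\<close> by auto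
  then have deg_b: "degree b + g + 1 = m"
    using deg_lhs eq assms(3) \<open>D \<noteq> 0\<close> by (simp add: degree_mult_eq degree_power_eq)
  have dvd: "D dvd a ^ 2 - [:k:]" "b dvd a ^ 2 - [:k:]"
    unfolding eq by (simp_all add: power2_eq_square)

  \<comment> \<open>The divisor \<open>b\<close> of \<open>a\<^sup>2 - k\<close> has odd degree here, so \<open>k\<close> must be a square.\<close>
  have part_a: "\<exists>c. k = c ^ 2" if "even m \<longleftrightarrow> even g"
  proof (rule ccontr)
    assume "\<nexists>c. k = c ^ 2"
    from divisor_is_norm[OF this \<open>b \<noteq> 0\<close> dvd(2)] have "even (degree b)"
      by auto
    with deg_b that show False
      by auto
  qed

  have part_b: "\<exists>s p q. (s > 0 \<or> (m = g + 1 \<and> odd m)) \<and> D = p * q \<and>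
      int (degree p) = int m - 2 * int s \<and>
      int (degree q) = 2 * int g + 2 + 2 * int s - int m" if square: "\<exists>c. k = c ^ 2"
  proof -
    obtain c where k: "k = c ^ 2"
      using square by blast
    then have "c \<noteq> 0"
      using \<open>k \<noteq> 0\<close> by auto
    have prod: "(a - [:c:]) * (a + [:c:]) = D * b ^ 2"
      unfolding eq[symmetric] k by (simp add: power2_eq_square algebra_simps)
    have nz: "(a - [:c:]) * (a + [:c:]) \<noteq> 0"
      using \<open>D \<noteq> 0\<close> \<open>b \<noteq> 0\<close> by (simp only: prod) simp
    have deg: "degree (a - [:c:]) = m" "degree (a + [:c:]) = m"
      using degree_diff_const[of "a + [:c:]" c] by (simp_all add: \<open>degree a = m\<close>)
    obtain p q r s where D: "D = p * q" and b: "b = r * s"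
      and p: "m = degree p + 2 * degree r" and q: "m = degree q + 2 * degree s"
      using coprime_factors_split[OF coprime_diff_add_const[OF \<open>c \<noteq> 0\<close>] prod nz] unfolding deg
      by blast
    have deg_pq: "degree p + degree q = 2 * g + 2"
      using assms(3) \<open>D \<noteq> 0\<close> by (simp add: D degree_mult_eq)
    have deg_rs: "degree r + degree s = degree b"
      using \<open>b \<noteq> 0\<close> by (simp add: b degree_mult_eq)
    consider "degree r > 0" | "degree s > 0" | "degree r = 0" "degree s = 0" "odd m"
      | "degree r = 0" "degree s = 0" "even m"
      by blast
    then show ?thesis
    proof cases
      case 1
      then show ?thesis
        using D p deg_pq by (intro exI[of _ "degree r"] exI[of _ p] exI[of _ q]) auto
    next
      case 2
      then show ?thesis
        using D q deg_pq by (intro exI[of _ "degree s"] exI[of _ q] exI[of _ p]) auto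
    next
      case 3
      then show ?thesis
        using D p deg_pq deg_rs deg_b by (intro exI[of _ 0] exI[of _ p] exI[of _ q]) auto
    next
      case 4
      \<comment> \<open>The unit yields only \<open>D = p q\<close> with both degrees \<open>m\<close>, hence no positive \<open>s\<close>; but as \<open>m\<close> is
        even, \<open>s = m / 2\<close> turns the asserted degrees into \<open>0\<close> and \<open>2 * g + 2\<close>.\<close>
      then have "m = g + 1"
        using deg_rs deg_b by simp
      moreover obtain s where "m = 2 * s"
        using 4 by blast
      ultimately show ?thesis
        using assms(3) by (intro exI[of _ s] exI[of _ 1] exI[of _ D]) auto
    qed
  qed

  have part_b': "\<not> irreducible D" if square: "\<exists>c. k = c ^ 2" and "odd m"
  proof
    assume "irreducible D"
    obtain s p q where D: "D = p * q" and deg: "int (degree p) = int m - 2 * int s"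
      "int (degree q) = 2 * int g + 2 + 2 * int s - int m"
      using part_b[OF square] by blast
    have "degree p \<noteq> 0" "degree q \<noteq> 0"
      using deg \<open>odd m\<close> by presburger+
    then have "\<not> is_unit p" "\<not> is_unit q"
      by (auto simp: is_unit_poly_iff)
    then show False
      using \<open>irreducible D\<close> D irreducibleD by blast
  qed

  have part_c: "\<exists>p q. set (coeffs p) \<subseteq> quad_field c \<and> set (coeffs q) \<subseteq> quad_field c \<and>
      q = map_poly (quad_conj c) p \<and> map_poly of_rat D = p * q \<and>
      degree p = g + 1 \<and> degree q = g + 1"
    if nonsquare: "\<nexists>r. k = r ^ 2" and c: "c ^ 2 = of_rat k" for c :: complex
  proof -
    have "c \<notin> \<rat>"
    proof
      assume "c \<in> \<rat>"
      then obtain r where "c = of_rat r"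
        by (auto elim: Rats_cases)
      with c have "of_rat (r ^ 2) = (of_rat k :: complex)"
        by (simp add: of_rat_power)
      with nonsquare show False
        by (metis of_rat_eq_iff)
    qed
    obtain A B where D: "D = A ^ 2 - smult k (B ^ 2)" and "degree D = 2 * degree A"
      and B: "B = 0 \<or> degree B < degree A"
      using divisor_is_norm[OF nonsquare \<open>D \<noteq> 0\<close> dvd(1)] unfolding assms(1) smult_1_left by blast
    then have "degree A = g + 1"
      using assms(3) by simp
    with conjugate_factorisation[OF \<open>c \<notin> \<rat>\<close> c B] show ?thesis
      unfolding D by (intro exI conjI) (assumption | simp only:)+
  qed

  show ?thesis
    using part_a part_b part_b' part_c by blast
qed

end
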